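(* Let $a \in \mathbb{N}=\{0,1,2,\dots\}$ and let $s \in \mathbb{C}$ with $\operatorname{Re}(s) > a+2$. Then for every real $x \geq 0$, $$ \sum_{k \geq 1} (-1)^k (k + x)^a\,\zeta(s, k + x) = - \frac{1}{2}E_a(x+1)\,\zeta(s,x+1) - \sum_{j=0}^{a} \sum_{\ell = 0}^{a-j} \frac{E_j}{2^{a-\ell + 1}}\binom{a}{j} \binom{a - j}{\ell}\, L\!\left(\tfrac12, s - \ell, x+1\right). $$
   Context: $\zeta(s,x) = \sum_{n\ge 0} (n+x)^{-s}$ denotes the Hurwitz zeta function. $L(\lambda,s,x) = \sum_{n \geq 0} \exp(2\pi i \lambda n)\,(n + x)^{-s}$ denotes the Lerch zeta function; in particular $L(\tfrac12,s,x)=\sum_{n\ge0}(-1)^n (n+x)^{-s}$. $E_n(x)$ denotes the $n$th Euler polynomial (generating function $2e^{xt}/(e^t+1)=\sum_n E_n(x)t^n/n!$), and $E_n$ the $n$th Euler number, $E_n = 2^n E_n(\tfrac12)$ (so $E_0=1$, $E_1=0$, $E_2=-1$, $\dots$). *)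

theory Defs
  imports "HOL-Analysis.Analysis" "HOL-Computational_Algebra.Formal_Power_Series"
begin

text \<open>
  The two zeta functions are given by their Dirichlet series, hence are only meaningful where these
  converge (no analytic continuation), and for \<^term>\<open>x > (0::real)\<close>.
\<close>

definition hurwitz_zeta :: "complex \<Rightarrow> real \<Rightarrow> complex" where
  "hurwitz_zeta s x = (\<Sum>n. of_real (real n + x) powr (- s))"

definition lerch_zeta :: "real \<Rightarrow> complex \<Rightarrow> real \<Rightarrow> complex" where
  "lerch_zeta l s x =
     (\<Sum>n. exp (2 * of_real pi * \<i> * of_real l * of_nat n) * of_real (real n + x) powr (- s))"

text \<open>
  \<open>euler_poly n x\<close> is the value at \<open>x\<close> of the \<open>n\<close>-th Euler polynomial, read off from the generating
  function \<open>2 e\<^sup>x\<^sup>t / (e\<^sup>t + 1)\<close> as a formal power series in \<open>t\<close>.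
\<close>

definition euler_poly :: "nat \<Rightarrow> real \<Rightarrow> real" where
  "euler_poly n x = fact n * fps_nth (2 * fps_exp x / (fps_exp 1 + 1)) n"

definition euler_number :: "nat \<Rightarrow> real" where
  "euler_number n = 2 ^ n * euler_poly n (1 / 2)"

end

theory Submission
  imports Defs
begin

text \<open>
  Put \<open>y = x + 1\<close> and let \<open>A\<^sub>K\<close> be the sum of \<open>(-1)\<^sup>k (k + y)\<^sup>a\<close> over \<open>k < K\<close>. Since
  \<open>\<zeta>(s, k + y) - \<zeta>(s, k + 1 + y) = (k + y)\<^sup>-\<^sup>s\<close>, Abel summation turns the series into the sum of
  \<open>A\<^bsub>m+1\<^esub> (m + y)\<^sup>-\<^sup>s\<close>; the boundary term \<open>A\<^sub>K \<zeta>(s, K + y)\<close> is dominated by a tail of the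
  convergent series of \<open>(m + y)\<^bsup>a + 1 - Re s\<^esup>\<close>. The functional equation
  \<open>E\<^sub>a(y + 1) + E\<^sub>a(y) = 2 y\<^sup>a\<close> gives \<open>A\<^bsub>m+1\<^esub> = (E\<^sub>a(y) + (-1)\<^sup>m E\<^sub>a(m + y + 1)) / 2\<close>, and
  expanding \<open>E\<^sub>a\<close> around \<open>1/2\<close> and then in powers of \<open>m + y\<close> yields the Lerch values.
\<close>

section \<open>Euler polynomials and alternating power sums\<close>

lemma fps_exp_plus_1_nth_0_neq_0: "fps_nth (fps_exp (1::real) + 1) 0 \<noteq> 0"
  by simp

text \<open>In the generating function, e^((x+1)t) + e^(xt) = e^(xt) (e^t + 1), and the last factor
  cancels the denominator, which is a unit because its constant coefficient is 2.\<close>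

lemma euler_poly_plus_1: "euler_poly n (x + 1) + euler_poly n x = 2 * x ^ n"
proof -
  let ?D = "fps_exp (1::real) + 1"
  have "2 * fps_exp (x + 1) / ?D + 2 * fps_exp x / ?D = (2 * fps_exp x) * ?D * inverse ?D"
    by (simp add: fps_divide_unit fps_exp_add_mult algebra_simps)
  also have "\<dots> = 2 * fps_exp x"
    using inverse_mult_eq_1'[OF fps_exp_plus_1_nth_0_neq_0] by (simp add: mult.assoc)
  finally have "fps_nth (2 * fps_exp (x + 1) / ?D) n + fps_nth (2 * fps_exp x / ?D) n
                  = fps_nth (2 * fps_exp x) n"
    by (metis fps_add_nth)
  also have "\<dots> = 2 * (x ^ n / fact n)"
    by (simp add: numeral_fps_const)
  finally have *: "fps_nth (2 * fps_exp (x + 1) / ?D) n + fps_nth (2 * fps_exp x / ?D) n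
                     = 2 * (x ^ n / fact n)" .
  show ?thesis
    unfolding euler_poly_def distrib_left[symmetric] * by simp
qed

text \<open>Replacing \<open>x\<close> by \<open>x + h\<close> multiplies the generating function by
  e^(ht); the right-hand side is the resulting Cauchy product.\<close>

lemma euler_poly_add:
  "euler_poly n (x + h) = (\<Sum>k=0..n. of_nat (n choose k) * euler_poly k x * h ^ (n - k))"
proof -
  let ?D = "fps_exp (1::real) + 1"
  have "2 * fps_exp (x + h) / ?D = (2 * fps_exp x / ?D) * fps_exp h"
    by (simp add: fps_divide_unit fps_exp_add_mult algebra_simps)
  then have "euler_poly n (x + h)
      = (\<Sum>k=0..n. fact n * (fps_nth (2 * fps_exp x / ?D) k * (h ^ (n - k) / fact (n - k))))"
    by (simp add: euler_poly_def fps_mult_nth sum_distrib_left)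
  also have "\<dots> = (\<Sum>k=0..n. of_nat (n choose k) * euler_poly k x * h ^ (n - k))"
    by (rule sum.cong) (auto simp: euler_poly_def binomial_fact field_simps)
  finally show ?thesis .
qed

lemma euler_poly_plus_1_expansion:
  "euler_poly a (z + 1) = (\<Sum>j=0..a. \<Sum>l=0..a - j.
     euler_number j / 2 ^ (a - l) * of_nat (a choose j) * of_nat ((a - j) choose l) * z ^ l)"
proof -
  have "euler_poly a (z + 1) = euler_poly a (1 / 2 + (z + 1 / 2))"
    by (simp add: algebra_simps)
  also have "\<dots> = (\<Sum>j=0..a. of_nat (a choose j) * euler_poly j (1 / 2) * (z + 1 / 2) ^ (a - j))"
    by (rule euler_poly_add)
  also have "\<dots> = (\<Sum>j=0..a. \<Sum>l=0..a - j.
     euler_number j / 2 ^ (a - l) * of_nat (a choose j) * of_nat ((a - j) choose l) * z ^ l)"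
  proof (rule sum.cong)
    fix j assume j: "j \<in> {0..a}"
    \<comment> \<open>The factor 2^j comes from the normalisation of \<open>euler_number j\<close>,
      the other one from the power of 1/2 in the binomial expansion of (z + 1/2)^(a-j).\<close>
    have "(2::real) ^ (a - l) = 2 ^ j * 2 ^ (a - j - l)" if "l \<le> a - j" for l
      using that j by (simp flip: power_add)
    then show "of_nat (a choose j) * euler_poly j (1 / 2) * (z + 1 / 2) ^ (a - j) = (\<Sum>l=0..a - j.
       euler_number j / 2 ^ (a - l) * of_nat (a choose j) * of_nat ((a - j) choose l) * z ^ l)"
      unfolding binomial_ring sum_distrib_left atLeast0AtMost
      by (intro sum.cong) (auto simp: euler_number_def power_one_over field_simps)
  qed simp
  finally show ?thesis .
qed

text \<open>By the functional equation each summand is half of E_a(k+y+1) + E_a(k+y), up to sign, so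
  the alternating sum telescopes and only its two ends remain.\<close>

lemma alternating_power_sum:
  "(\<Sum>k\<le>m. (-1) ^ k * (real k + y) ^ a) = (euler_poly a y + (-1) ^ m * euler_poly a (real m + y + 1)) / 2"
proof (induction m)
  case 0
  then show ?case using euler_poly_plus_1[of a y] by simp
next
  case (Suc m)
  have "(-1) ^ m * (real m + y + 1) ^ a
          = (-1) ^ m * (euler_poly a (real m + y + 1 + 1) + euler_poly a (real m + y + 1)) / 2"
    using euler_poly_plus_1[of a "real m + y + 1"] by simp
  with Suc show ?case by (simp add: field_simps)
qed

section \<open>Convergence of the Hurwitz and Lerch series\<close>

lemma summable_shifted_powr:
  fixes y p :: real
  assumes "y \<ge> 0" "p < -1"
  shows "summable (\<lambda>n. (real n + y) powr p)"
proof (rule summable_comparison_test)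
  show "summable (\<lambda>n. real n powr p)"
    using assms by (simp add: summable_real_powr_iff)
  \<comment> \<open>The index 0 is left out because \<open>0 powr p\<close> is 0 by convention,
    which does not dominate \<open>y powr p\<close> for positive \<open>y\<close>.\<close>
  have "(real n + y) powr p \<le> real n powr p" if "n \<ge> 1" for n
    using assms that by (intro powr_mono2') auto
  then show "\<exists>N. \<forall>n\<ge>N. norm ((real n + y) powr p) \<le> real n powr p"
    by auto
qed

lemma norm_of_real_powr:
  assumes "r > 0" shows "norm (of_real r powr z) = r powr Re z"
  using assms by (simp add: norm_powr_real_powr)

lemma summable_hurwitz_zeta:
  assumes "y > 0" "Re s > 1"
  shows "summable (\<lambda>n. norm (of_real (real n + y) powr (- s)))"
  using summable_shifted_powr[of y "- Re s"] assms
  by (subst norm_of_real_powr) auto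

lemma hurwitz_zeta_sums:
  assumes "y > 0" "Re s > 1"
  shows "(\<lambda>n. of_real (real n + y) powr (- s)) sums hurwitz_zeta s y"
  unfolding hurwitz_zeta_def
  by (intro summable_sums summable_norm_cancel[OF summable_hurwitz_zeta] assms)

text \<open>The shift drops the first term of the series. This supplies the differences that enter
  the summation by parts.\<close>

lemma hurwitz_zeta_plus_1:
  assumes "y > 0" "Re s > 1"
  shows "hurwitz_zeta s (y + 1) = hurwitz_zeta s y - of_real y powr (- s)"
proof -
  have "(\<lambda>n. of_real (real (Suc n) + y) powr (- s)) sums (hurwitz_zeta s y - of_real (real 0 + y) powr (- s))"
    using hurwitz_zeta_sums[OF assms]
    by (subst sums_Suc_iff) simp
  moreover have "(\<lambda>n. of_real (real (Suc n) + y) powr (- s)) sums hurwitz_zeta s (y + 1)"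
    using hurwitz_zeta_sums[of "y + 1" s] assms by (simp add: add_ac)
  ultimately show ?thesis
    using sums_unique2 by fastforce
qed

lemma lerch_zeta_half_sums:
  assumes "y > 0" "Re s > 1"
  shows "(\<lambda>n. (-1) ^ n * of_real (real n + y) powr (- s)) sums lerch_zeta (1 / 2) s y"
proof -
  have "exp (2 * of_real pi * \<i> * of_real (1 / 2) * of_nat n) = (-1) ^ n" for n :: nat
  proof -
    have "exp (2 * of_real pi * \<i> * of_real (1 / 2) * of_nat n) = exp (of_nat n * (\<i> * of_real pi))"
      by (simp add: algebra_simps)
    also have "\<dots> = (-1) ^ n"
      by (subst exp_of_nat_mult) (simp add: exp_pi_i')
    finally show ?thesis .
  qed
  moreover have "summable (\<lambda>n. (-1) ^ n * complex_of_real (real n + y) powr (- s))"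
    by (rule summable_norm_cancel)
       (use summable_hurwitz_zeta[OF assms] in \<open>simp add: norm_mult norm_power\<close>)
  ultimately show ?thesis
    unfolding lerch_zeta_def by (simp add: summable_sums)
qed

section \<open>Boundary term and summation by parts\<close>

lemma alternating_power_hurwitz_zeta_tendsto_0:
  assumes "y \<ge> 1" "Re s > real a + 2"
  shows "(\<lambda>K. of_real (\<Sum>k<K. (-1) ^ k * (real k + y) ^ a) * hurwitz_zeta s (real K + y)) \<longlonglongrightarrow> 0"
proof (rule Lim_null_comparison)
  let ?p = "real a + 1 - Re s"
  have sm: "summable (\<lambda>n. (real n + y) powr ?p)"
    using assms by (intro summable_shifted_powr) auto
  show "(\<lambda>K. \<Sum>n. (real (n + K) + y) powr ?p) \<longlonglongrightarrow> 0"
    using suminf_exist_split2[OF sm] by simp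
  have "norm (of_real (\<Sum>k<K. (-1) ^ k * (real k + y) ^ a) * hurwitz_zeta s (real K + y))
          \<le> (\<Sum>n. (real (n + K) + y) powr ?p)" for K
  proof -
    have "\<bar>\<Sum>k<K. (-1) ^ k * (real k + y) ^ a\<bar> \<le> (\<Sum>k<K. \<bar>(-1) ^ k * (real k + y) ^ a\<bar>)"
      by (rule sum_abs)
    also have "\<dots> \<le> (\<Sum>k<K. (real K + y) ^ a)"
      using assms by (intro sum_mono) (auto simp: abs_mult power_abs intro!: power_mono)
    \<comment> \<open>There are \<open>K\<close> equal summands, and \<open>K\<close> is at most
      \<open>K + y\<close>; cancellation between the signs is not exploited.\<close>
    also have "\<dots> \<le> (real K + y) ^ (a + 1)"
      using assms by (simp add: mult_right_mono)
    finally have A: "\<bar>\<Sum>k<K. (-1) ^ k * (real k + y) ^ a\<bar> \<le> (real K + y) ^ (a + 1)" .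
    have z: "summable (\<lambda>n. norm (of_real (real n + (real K + y)) powr (- s)))"
      using assms by (intro summable_hurwitz_zeta) auto
    have t: "summable (\<lambda>n. (real (n + K) + y) powr ?p)"
      using sm by (subst summable_iff_shift)
    have "norm (of_real (\<Sum>k<K. (-1) ^ k * (real k + y) ^ a) * hurwitz_zeta s (real K + y))
            \<le> (real K + y) ^ (a + 1) * (\<Sum>n. norm (of_real (real n + (real K + y)) powr (- s)))"
      unfolding norm_mult hurwitz_zeta_def norm_of_real
      using A summable_norm[OF z] assms by (intro mult_mono) auto
    also have "\<dots> = (\<Sum>n. (real K + y) ^ (a + 1) * norm (of_real (real n + (real K + y)) powr (- s)))"
      using z by (rule suminf_mult[symmetric])
    also have "\<dots> \<le> (\<Sum>n. (real (n + K) + y) powr ?p)"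
    proof (rule suminf_le)
      fix n
      have pos: "real n + (real K + y) > 0" using assms by auto
      \<comment> \<open>The prefactor is moved into the series, where its base \<open>K + y\<close>
        may be enlarged to that of the term. What results is a tail of a fixed series whose exponent
        is below -1.\<close>
      have "(real K + y) ^ (a + 1) * norm (of_real (real n + (real K + y)) powr (- s))
             \<le> (real n + (real K + y)) ^ (a + 1) * (real n + (real K + y)) powr (- Re s)"
        unfolding norm_of_real_powr[OF pos] using assms
        by (intro mult_mono power_mono) auto
      also have "\<dots> = (real n + (real K + y)) powr (real (a + 1) + - Re s)"
        unfolding powr_add powr_realpow[OF pos] ..
      finally show "(real K + y) ^ (a + 1) * norm (of_real (real n + (real K + y)) powr (- s))
                      \<le> (real (n + K) + y) powr ?p"
        by (simp add: algebra_simps)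
    qed (use z t in \<open>auto intro: summable_mult\<close>)
    finally show ?thesis .
  qed
  then show "\<forall>\<^sub>F K in sequentially. norm (of_real (\<Sum>k<K. (-1) ^ k * (real k + y) ^ a)
      * hurwitz_zeta s (real K + y)) \<le> (\<Sum>n. (real (n + K) + y) powr ?p)"
    by simp
qed

text \<open>The finite Abel identity has boundary term \<open>d K\<close> times the sum over
  \<open>k < K\<close>, so it also holds for \<open>K = 0\<close> and follows by induction; the
  second assumption removes this term in the limit.\<close>

lemma sums_by_parts:
  fixes c d :: "nat \<Rightarrow> 'a :: {real_normed_algebra}"
  assumes "(\<lambda>m. (\<Sum>k\<le>m. c k) * (d m - d (Suc m))) sums S"
    and "(\<lambda>K. (\<Sum>k<K. c k) * d K) \<longlonglongrightarrow> 0"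
  shows "(\<lambda>k. c k * d k) sums S"
proof -
  have "(\<Sum>k<K. c k * d k)
          = (\<Sum>m<K. (\<Sum>k\<le>m. c k) * (d m - d (Suc m))) + (\<Sum>k<K. c k) * d K" for K
    by (induction K) (simp_all add: algebra_simps flip: lessThan_Suc_atMost)
  then show ?thesis
    using tendsto_add[OF assms(1)[unfolded sums_def] assms(2)] by (simp add: sums_def)
qed

section \<open>Evaluation of the series\<close>

lemma of_real_power_mult_powr:
  assumes "r > 0"
  shows "of_real r ^ l * of_real r powr (- s) = complex_of_real r powr (- (s - of_nat l))"
proof -
  have "complex_of_real r powr (of_nat l + - s) = of_real r ^ l * of_real r powr (- s)"
    unfolding powr_add using assms by (simp add: powr_nat')
  then show ?thesis by simp
qed

text \<open>The monomial (m+y)^l of the expanded polynomial is absorbed into the exponent, turning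
  \<open>s\<close> into \<open>s - l\<close>. Since \<open>l\<close> is at most \<open>a\<close>,
  the real part of \<open>s - l\<close> stays above 1, and the finite sums can be taken out of the
  convergent Lerch series.\<close>

lemma alternating_euler_poly_sums:
  assumes "y > 0" "Re s > real a + 1"
  shows "(\<lambda>m. (-1) ^ m * of_real (euler_poly a (real m + y + 1)) * of_real (real m + y) powr (- s))
    sums (\<Sum>j=0..a. \<Sum>l=0..a - j. of_real (euler_number j) / 2 ^ (a - l) * of_nat (a choose j)
            * of_nat ((a - j) choose l) * lerch_zeta (1 / 2) (s - of_nat l) y)"
proof -
  have "(\<lambda>m. \<Sum>j=0..a. \<Sum>l=0..a - j. of_real (euler_number j) / 2 ^ (a - l) * of_nat (a choose j)
            * of_nat ((a - j) choose l) * ((-1) ^ m * of_real (real m + y) powr (- (s - of_nat l))))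
    sums (\<Sum>j=0..a. \<Sum>l=0..a - j. of_real (euler_number j) / 2 ^ (a - l) * of_nat (a choose j)
            * of_nat ((a - j) choose l) * lerch_zeta (1 / 2) (s - of_nat l) y)"
    using assms by (intro sums_sum sums_mult lerch_zeta_half_sums) auto
  moreover have "(\<Sum>j=0..a. \<Sum>l=0..a - j. of_real (euler_number j) / 2 ^ (a - l) * of_nat (a choose j)
            * of_nat ((a - j) choose l) * ((-1) ^ m * of_real (real m + y) powr (- (s - of_nat l))))
      = (-1) ^ m * of_real (euler_poly a (real m + y + 1)) * of_real (real m + y) powr (- s)" for m
  proof -
    have pos: "real m + y > 0" using assms by simp
    show ?thesis
      unfolding euler_poly_plus_1_expansion of_real_sum sum_distrib_left sum_distrib_right
        of_real_power_mult_powr[OF pos, symmetric]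
      by (intro sum.cong refl) (simp add: mult_ac)
  qed
  ultimately show ?thesis by simp
qed

lemma alternating_hurwitz_zeta_sums:
  assumes "y \<ge> 1" "Re s > real a + 2"
  shows "(\<lambda>k. (-1) ^ k * of_real (real k + y) ^ a * hurwitz_zeta s (real k + y)) sums
    ((of_real (euler_poly a y) * hurwitz_zeta s y
       + (\<Sum>j=0..a. \<Sum>l=0..a - j. of_real (euler_number j) / 2 ^ (a - l) * of_nat (a choose j)
            * of_nat ((a - j) choose l) * lerch_zeta (1 / 2) (s - of_nat l) y)) / 2)"
    (is "_ sums ((?E * _ + ?L) / 2)")
proof (rule sums_by_parts)
  have "(\<lambda>m. (?E * of_real (real m + y) powr (- s)
          + (-1) ^ m * of_real (euler_poly a (real m + y + 1)) * of_real (real m + y) powr (- s)) / 2)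
        sums ((?E * hurwitz_zeta s y + ?L) / 2)"
    using assms
    by (intro sums_divide sums_add sums_mult hurwitz_zeta_sums alternating_euler_poly_sums) auto
  moreover have "(\<Sum>k\<le>m. (-1) ^ k * of_real (real k + y) ^ a)
        * (hurwitz_zeta s (real m + y) - hurwitz_zeta s (real (Suc m) + y))
      = (?E * of_real (real m + y) powr (- s)
          + (-1) ^ m * of_real (euler_poly a (real m + y + 1)) * of_real (real m + y) powr (- s)) / 2" for m
  proof -
    have "(\<Sum>k\<le>m. (-1) ^ k * complex_of_real (real k + y) ^ a)
            = of_real (\<Sum>k\<le>m. (-1) ^ k * (real k + y) ^ a)"
      by simp
    also have "\<dots> = (?E + (-1) ^ m * of_real (euler_poly a (real m + y + 1))) / 2"
      unfolding alternating_power_sum by simp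
    finally have 1: "(\<Sum>k\<le>m. (-1) ^ k * complex_of_real (real k + y) ^ a)
      = (?E + (-1) ^ m * of_real (euler_poly a (real m + y + 1))) / 2" .
    have 2: "hurwitz_zeta s (real m + y) - hurwitz_zeta s (real (Suc m) + y) = of_real (real m + y) powr (- s)"
      using hurwitz_zeta_plus_1[of "real m + y" s] assms by (simp add: add_ac)
    show ?thesis
      unfolding 1 2 by (simp only: distrib_right times_divide_eq_left)
  qed
  ultimately show "(\<lambda>m. (\<Sum>k\<le>m. (-1) ^ k * of_real (real k + y) ^ a)
        * (hurwitz_zeta s (real m + y) - hurwitz_zeta s (real (Suc m) + y)))
      sums ((?E * hurwitz_zeta s y + ?L) / 2)"
    by (simp only:)
  show "(\<lambda>K. (\<Sum>k<K. (-1) ^ k * of_real (real k + y) ^ a) * hurwitz_zeta s (real K + y)) \<longlonglongrightarrow> 0"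
    using alternating_power_hurwitz_zeta_tendsto_0[OF assms] by simp
qed

theorem theorem1p8:
  fixes a :: nat and s :: complex and x :: real
  assumes "Re s > real a + 2" and "x \<ge> 0"
  shows "(\<lambda>k. (-1) ^ (k + 1) * of_real (real (k + 1) + x) ^ a * hurwitz_zeta s (real (k + 1) + x))
    sums
      (- (1 / 2) * of_real (euler_poly a (x + 1)) * hurwitz_zeta s (x + 1)
       - (\<Sum>j=0..a. \<Sum>l=0..a - j.
            of_real (euler_number j) / 2 ^ (a - l + 1) * of_nat (a choose j) * of_nat ((a - j) choose l)
            * lerch_zeta (1 / 2) (s - of_nat l) (x + 1)))"
proof -
  let ?L = "\<Sum>j=0..a. \<Sum>l=0..a - j. of_real (euler_number j) / 2 ^ (a - l) * of_nat (a choose j)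
            * of_nat ((a - j) choose l) * lerch_zeta (1 / 2) (s - of_nat l) (x + 1)"
  \<comment> \<open>The extra factor 2 in each denominator is the 1/2 of the closed form of the
    alternating power sums.\<close>
  have L: "(\<Sum>j=0..a. \<Sum>l=0..a - j.
            of_real (euler_number j) / 2 ^ (a - l + 1) * of_nat (a choose j) * of_nat ((a - j) choose l)
            * lerch_zeta (1 / 2) (s - of_nat l) (x + 1)) = ?L / 2"
    unfolding sum_divide_distrib by (intro sum.cong refl) simp
  \<comment> \<open>The sum over k >= 1 is indexed from 0, which makes \<open>x + 1\<close> the base
    point, at least 1, and reverses the overall sign.\<close>
  have shift: "real (k + 1) + x = real k + (x + 1)" for k
    by simp
  have sign: "(-1) ^ (k + 1) * u * v = - ((-1) ^ k * u * v)" for k and u v :: complex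
    by simp
  have val: "- (1 / 2) * e * z - w / 2 = - ((e * z + w) / 2)" for e z w :: complex
    by (simp add: field_simps)
  show ?thesis
    unfolding L shift sign val
    by (rule sums_minus[OF alternating_hurwitz_zeta_sums]) (use assms in auto)
qed

end
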